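(* Every modular graph $G$ with $G^2$-connected medians is an ABC-graph, i.e., the median function is the unique consensus function on $G$ satisfying the axioms (A), (B), (C). In particular, every bipartite Helly graph is an ABC-graph.
   Context: All graphs are undirected, simple and connected; $d$ is the graph distance, $I(u,v)=\{w: d(u,w)+d(w,v)=d(u,v)\}$, and $B_r(v)=\{x: d(v,x)\le r\}$. A graph is modular if for every three vertices $x,y,z$ the set $I(x,y)\cap I(y,z)\cap I(z,x)$ is nonempty. A profile is a finite sequence $\pi=(x_1,\dots,x_n)$ of vertices (repetitions allowed); $V^*$ is the set of profiles, $\pi\rho$ is concatenation. A consensus function is a map $L:V^*\to 2^V\setminus\{\emptyset\}$. $F_\pi(v)=\sum_i d(v,x_i)$ and $\mathrm{Med}(\pi)$ is the set of minimizers of $F_\pi$ (the median function). $G^2$ is the graph on $V$ where $u\ne v$ are adjacent iff $d(u,v)\le 2$; $G$ has $G^2$-connected medians if for every profile $\pi$, $\mathrm{Med}(\pi)$ induces a connected subgraph of $G^2$. A bipartite graph with color classes $X,Y$ is a bipartite Helly graph if the family of half-balls $B_r(v)\cap X$ and $B_r(v)\cap Y$ ($v\in V$, $r\ge 0$) has the Helly property: every finite subfamily of pairwise intersecting half-balls has nonempty intersection. Axioms: (A) Anonymity: $L$ is invariant under permutation of the profile; (B) Betweenness: $L(u,v)=I(u,v)$ for all $u,v$; (C) Consistency: if $L(\pi)\cap L(\rho)\ne\emptyset$ then $L(\pi\rho)=L(\pi)\cap L(\rho)$. An ABC-graph is a graph on which the median function is the only consensus function satisfying (A), (B), (C). *)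

theory Defs
  imports
    "Graph_Theory.Pair_Digraph"
    "Graph_Theory.Digraph_Component"
    "HOL-Library.FuncSet"
    "HOL-Library.Multiset"
begin

text \<open>
  Following the library, an undirected simple graph is a symmetric loop-free digraph without
  parallel arcs. The vertex set may be infinite. It is nonempty, as connectedness includes this.
\<close>

definition connected_simple_graph :: "'a pair_pre_digraph \<Rightarrow> bool" where
  "connected_simple_graph G \<longleftrightarrow>
     pair_bidirected_digraph G \<and> Digraph_Component.connected (with_proj G)"

definition gdist :: "'a pair_pre_digraph \<Rightarrow> 'a \<Rightarrow> 'a \<Rightarrow> nat" where
  "gdist G u v = (LEAST n. \<exists>p. pre_digraph.awalk (with_proj G) u p v \<and> length p = n)"

definition ginterval :: "'a pair_pre_digraph \<Rightarrow> 'a \<Rightarrow> 'a \<Rightarrow> 'a set" where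
  "ginterval G u v = {w \<in> pverts G. gdist G u w + gdist G w v = gdist G u v}"

definition gball :: "'a pair_pre_digraph \<Rightarrow> nat \<Rightarrow> 'a \<Rightarrow> 'a set" where
  "gball G r v = {x \<in> pverts G. gdist G v x \<le> r}"

definition modular_graph :: "'a pair_pre_digraph \<Rightarrow> bool" where
  "modular_graph G \<longleftrightarrow>
     (\<forall>x\<in>pverts G. \<forall>y\<in>pverts G. \<forall>z\<in>pverts G.
        ginterval G x y \<inter> ginterval G y z \<inter> ginterval G z x \<noteq> {})"

abbreviation profiles :: "'a pair_pre_digraph \<Rightarrow> 'a list set" where
  "profiles G \<equiv> lists (pverts G)"

definition consensus_functions :: "'a pair_pre_digraph \<Rightarrow> ('a list \<Rightarrow> 'a set) set" where
  "consensus_functions G = (profiles G \<rightarrow> Pow (pverts G) - {{}})"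

definition remoteness :: "'a pair_pre_digraph \<Rightarrow> 'a list \<Rightarrow> 'a \<Rightarrow> nat" where
  "remoteness G \<pi> v = (\<Sum>x\<leftarrow>\<pi>. gdist G v x)"

definition Med :: "'a pair_pre_digraph \<Rightarrow> 'a list \<Rightarrow> 'a set" where
  "Med G \<pi> = {v \<in> pverts G. \<forall>u\<in>pverts G. remoteness G \<pi> v \<le> remoteness G \<pi> u}"

definition graph_square :: "'a pair_pre_digraph \<Rightarrow> 'a pair_pre_digraph" where
  "graph_square G =
     \<lparr> pverts = pverts G,
       parcs = {(u, v). u \<in> pverts G \<and> v \<in> pverts G \<and> u \<noteq> v \<and> gdist G u v \<le> 2} \<rparr>"

definition G2_connected_medians :: "'a pair_pre_digraph \<Rightarrow> bool" where
  "G2_connected_medians G \<longleftrightarrow>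
     (\<forall>\<pi>\<in>profiles G. Digraph_Component.connected (with_proj (graph_square G) \<restriction> Med G \<pi>))"

definition bipartition :: "'a pair_pre_digraph \<Rightarrow> 'a set \<Rightarrow> 'a set \<Rightarrow> bool" where
  "bipartition G X Y \<longleftrightarrow>
     X \<union> Y = pverts G \<and> X \<inter> Y = {} \<and> parcs G \<subseteq> X \<times> Y \<union> Y \<times> X"

text \<open>
  The case \<open>A = B\<close> below makes the members of the subfamily nonempty. This matters: the half-ball
  \<open>gball G 0 v \<inter> X\<close> is empty for \<open>v \<in> Y\<close>, and must not count as a pairwise intersecting subfamily
  on its own.
\<close>

definition Helly_property :: "'a set set \<Rightarrow> bool" where
  "Helly_property \<F> \<longleftrightarrow>
     (\<forall>\<G>\<subseteq>\<F>. finite \<G> \<longrightarrow> (\<forall>A\<in>\<G>. \<forall>B\<in>\<G>. A \<inter> B \<noteq> {}) \<longrightarrow> \<Inter>\<G> \<noteq> {})"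

definition half_balls :: "'a pair_pre_digraph \<Rightarrow> 'a set \<Rightarrow> 'a set \<Rightarrow> 'a set set" where
  "half_balls G X Y =
     {gball G r v \<inter> X | r v. v \<in> pverts G} \<union> {gball G r v \<inter> Y | r v. v \<in> pverts G}"

definition bipartite_Helly_graph :: "'a pair_pre_digraph \<Rightarrow> bool" where
  "bipartite_Helly_graph G \<longleftrightarrow>
     (\<exists>X Y. bipartition G X Y \<and> Helly_property (half_balls G X Y))"

definition anonymity :: "'a pair_pre_digraph \<Rightarrow> ('a list \<Rightarrow> 'a set) \<Rightarrow> bool" where
  "anonymity G L \<longleftrightarrow>
     (\<forall>\<pi>\<in>profiles G. \<forall>\<rho>\<in>profiles G. mset \<pi> = mset \<rho> \<longrightarrow> L \<pi> = L \<rho>)"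

definition betweenness :: "'a pair_pre_digraph \<Rightarrow> ('a list \<Rightarrow> 'a set) \<Rightarrow> bool" where
  "betweenness G L \<longleftrightarrow> (\<forall>u\<in>pverts G. \<forall>v\<in>pverts G. L [u, v] = ginterval G u v)"

definition consistency :: "'a pair_pre_digraph \<Rightarrow> ('a list \<Rightarrow> 'a set) \<Rightarrow> bool" where
  "consistency G L \<longleftrightarrow>
     (\<forall>\<pi>\<in>profiles G. \<forall>\<rho>\<in>profiles G. L \<pi> \<inter> L \<rho> \<noteq> {} \<longrightarrow> L (\<pi> @ \<rho>) = L \<pi> \<inter> L \<rho>)"

definition ABC_function :: "'a pair_pre_digraph \<Rightarrow> ('a list \<Rightarrow> 'a set) \<Rightarrow> bool" where
  "ABC_function G L \<longleftrightarrow>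
     L \<in> consensus_functions G \<and> anonymity G L \<and> betweenness G L \<and> consistency G L"

text \<open>Consensus functions are identified when they agree on all profiles of the graph.\<close>

definition ABC_graph :: "'a pair_pre_digraph \<Rightarrow> bool" where
  "ABC_graph G \<longleftrightarrow>
     ABC_function G (Med G) \<and>
     (\<forall>L. ABC_function G L \<longrightarrow> (\<forall>\<pi>\<in>profiles G. L \<pi> = Med G \<pi>))"

end

theory Submission
  imports Defs
begin

text \<open>
  Let \<open>L\<close> satisfy the axioms on a modular graph, and write \<open>F\<close> for the remoteness of a profile \<open>\<pi>\<close>.
  If \<open>uv\<close> is an edge, then each \<open>x\<close> is closer to one end, say to \<open>u\<close>, and then \<open>L(x, v)\<close> contains
  both \<open>u\<close> and \<open>v\<close>. Completing \<open>\<pi>\<close> by copies of \<open>u\<close> and \<open>v\<close> therefore shows that \<open>u \<in> L(\<pi>)\<close>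
  implies \<open>F(u) \<le> F(v)\<close>, and that \<open>v \<in> L(\<pi>)\<close> in the case of equality.

  The same holds for vertices \<open>u, v\<close> at distance 2. The main case is that \<open>F(u) = F(v) < F(z)\<close> for
  all common neighbours \<open>z\<close>. Then there are two of them, \<open>z\<close> and \<open>z'\<close>. Put \<open>t = F(z) - F(u)\<close>
  and \<open>t' = F(z') - F(u)\<close>. Adding \<open>t\<close> copies of \<open>z\<close> and many copies of \<open>u, v\<close> to \<open>\<pi>\<close> gives a profile
  whose local minima are \<open>u, v, z\<close>, so its consensus contains all three by the result for edges;
  likewise for \<open>z'\<close>. Taking \<open>t'\<close> copies of the first profile and \<open>t\<close> of the second, one obtains
  \<open>t + t'\<close> copies of \<open>\<pi>\<close> together with copies of the pairs \<open>u, v\<close> and \<open>z, z'\<close>, and \<open>u\<close> lies in the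
  consensus of each of these parts. By consistency so does \<open>v\<close>.

  Connectedness of medians in the square of the graph makes minima over balls of radius 2 global,
  whence \<open>L(\<pi>)\<close> is contained in the median set, and it spreads \<open>L(\<pi>)\<close> over that set.

  In a bipartite Helly graph, two vertices \<open>u, v\<close> at distance at least 3 can be moved by two steps
  towards each other without increasing the sum of their distances to any vertex of \<open>\<pi>\<close>: the
  required positions are common points of pairwise intersecting half-balls.
\<close>

section \<open>Distances in connected graphs\<close>

locale connected_graph =
  fixes G :: "'a pair_pre_digraph"
  assumes csg: "connected_simple_graph G"
begin

abbreviation "V \<equiv> pverts G"
abbreviation "d \<equiv> gdist G"

sublocale bi: pair_bidirected_digraph G
  using csg by (simp add: connected_simple_graph_def)

lemma verts_nonempty: "V \<noteq> {}"
  using csg by (simp add: connected_simple_graph_def connected_def strongly_connected_def)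

lemma walk_exists:
  assumes "u \<in> V" "v \<in> V"
  shows "\<exists>p. bi.awalk u p v"
proof -
  have "strongly_connected (with_proj G)"
    using csg bi.symmetric_connected_imp_strongly_connected bi.pair_sym_arcs
    by (simp add: connected_simple_graph_def)
  then show ?thesis
    using assms bi.reachable_awalk by (auto simp: strongly_connected_def)
qed

lemma shortest_walk:
  assumes "u \<in> V" "v \<in> V"
  obtains p where "bi.awalk u p v" "length p = d u v"
proof -
  have "\<exists>n p. bi.awalk u p v \<and> length p = n"
    using walk_exists[OF assms] by blast
  from LeastI_ex[OF this] show ?thesis
    using that by (auto simp: gdist_def)
qed

lemma dist_le_length:
  assumes "bi.awalk u p v"
  shows "d u v \<le> length p"
  unfolding gdist_def by (rule Least_le) (use assms in blast)

lemma dist_refl [simp]: "u \<in> V \<Longrightarrow> d u u = 0"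
  using dist_le_length[of u "[]" u] by (simp add: bi.awalk_Nil_iff)

lemma dist_eq_0: "u \<in> V \<Longrightarrow> v \<in> V \<Longrightarrow> d u v = 0 \<longleftrightarrow> u = v"
  by (metis bi.awalk_Nil_iff dist_refl length_0_conv shortest_walk)

lemma length_rev_path: "length (rev_path p) = length p"
  by (induction p) auto

lemma dist_sym:
  assumes "u \<in> V" "v \<in> V"
  shows "d u v = d v u"
proof -
  have "d b a \<le> d a b" if "a \<in> V" "b \<in> V" for a b
    by (metis that shortest_walk bi.awalk_rev_path dist_le_length length_rev_path)
  then show ?thesis
    using assms by (simp add: order_antisym)
qed

lemma dist_triangle:
  assumes "u \<in> V" "v \<in> V" "w \<in> V"
  shows "d u w \<le> d u v + d v w"
proof -
  obtain p q where "bi.awalk u p v" "length p = d u v" "bi.awalk v q w" "length q = d v w"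
    using assms shortest_walk by metis
  then show ?thesis
    using dist_le_length[of u "p @ q" w] by (metis bi.awalk_appendI length_append)
qed

lemma geodesic_step:
  assumes "u \<in> V" "v \<in> V" "u \<noteq> v"
  obtains w where "w \<in> V" "(u, w) \<in> parcs G" "d u w = 1" "d u v = Suc (d w v)"
proof -
  obtain p where p: "bi.awalk u p v" "length p = d u v"
    using assms shortest_walk by metis
  with assms obtain e q where q: "p = e # q"
    by (cases p) (auto simp: bi.awalk_Nil_iff)
  let ?w = "snd e"
  have e: "e \<in> parcs G" "fst e = u" "bi.awalk ?w q v"
    using p q by (auto simp: bi.awalk_Cons_iff)
  have w: "?w \<in> V" "u \<noteq> ?w"
    using e bi.arc_snd_in_verts bi.pair_no_loops by auto
  have "bi.awalk u [e] ?w"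
    using e w by (auto simp: bi.awalk_Cons_iff bi.awalk_Nil_iff)
  then have "d u ?w \<le> 1"
    using dist_le_length[of u "[e]" ?w] by simp
  then have 1: "d u ?w = 1"
    using w assms dist_eq_0[of u ?w] by linarith
  moreover have "d ?w v \<le> length q"
    using e dist_le_length by blast
  ultimately have "d u v = Suc (d ?w v)"
    using p q dist_triangle[OF assms(1) w(1) assms(2)] by simp
  moreover have "(u, ?w) \<in> parcs G"
    using e by (metis prod.collapse)
  ultimately show ?thesis
    using that w 1 by blast
qed

lemma geodesic_point:
  assumes "u \<in> V" "v \<in> V" "k \<le> d u v"
  obtains w where "w \<in> V" "d u w = k" "d u v = k + d w v"
proof -
  have "\<exists>w\<in>V. d u w = k \<and> d u v = k + d w v"
    using assms(3)
  proof (induction k)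
    case 0
    then show ?case using assms by (auto intro: bexI[of _ u])
  next
    case (Suc k)
    then obtain w where w: "w \<in> V" "d u w = k" "d u v = k + d w v"
      by auto
    then have "w \<noteq> v"
      using Suc.prems by auto
    then obtain x where "x \<in> V" "d w x = 1" "d w v = Suc (d x v)"
      using geodesic_step w assms by metis
    then show ?case
      using w dist_triangle[of u w x] dist_triangle[of u x v] assms
      by (intro bexI[of _ x]) auto
  qed
  then show ?thesis using that by blast
qed

lemma ginterval_iff: "w \<in> ginterval G u v \<longleftrightarrow> w \<in> V \<and> d u w + d w v = d u v"
  by (simp add: ginterval_def)

lemma interval_self: "u \<in> V \<Longrightarrow> ginterval G u u = {u}"
  by (auto simp: ginterval_iff dist_eq_0)

section \<open>Remoteness and medians\<close>

definition remote :: "'a multiset \<Rightarrow> 'a \<Rightarrow> nat" where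
  "remote m v = (\<Sum>x\<in>#m. d v x)"

lemma remote_simps [simp]:
  "remote {#} v = 0"
  "remote (add_mset x m) v = d v x + remote m v"
  "remote (m + n) v = remote m v + remote n v"
  "remote (replicate_mset k x) v = k * d v x"
  by (simp_all add: remote_def)

lemma remote_repeat_mset [simp]: "remote (repeat_mset k m) v = k * remote m v"
  by (induction k) simp_all

lemma in_repeat_msetD: "x \<in># repeat_mset k m \<Longrightarrow> x \<in># m"
  by (induction k) auto

lemma remoteness_eq_remote: "remoteness G \<pi> = remote (mset \<pi>)"
  by (rule ext) (simp add: remoteness_def remote_def flip: sum_mset_sum_list)

lemma remote_Lipschitz:
  assumes "set_mset m \<subseteq> V" "u \<in> V" "v \<in> V"
  shows "remote m u \<le> remote m v + size m * d u v"
  using assms(1)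
proof (induction m)
  case (add x m)
  then show ?case using dist_triangle[of u v x] assms by auto
qed simp

definition med :: "'a multiset \<Rightarrow> 'a set" where
  "med m = {v \<in> V. \<forall>u\<in>V. remote m v \<le> remote m u}"

lemma Med_eq_med: "Med G \<pi> = med (mset \<pi>)"
  by (simp add: Med_def med_def remoteness_eq_remote)

lemma Med_iff: "v \<in> Med G \<pi> \<longleftrightarrow> v \<in> V \<and> (\<forall>u\<in>V. remote (mset \<pi>) v \<le> remote (mset \<pi>) u)"
  by (simp add: Med_eq_med med_def)

lemma Med_nonempty: "Med G \<pi> \<noteq> {}"
proof -
  obtain v where "v \<in> V" "\<forall>u. u \<in> V \<longrightarrow> remote (mset \<pi>) v \<le> remote (mset \<pi>) u"
    using verts_nonempty ex_has_least_nat[of "\<lambda>v. v \<in> V"] by blast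
  then have "v \<in> Med G \<pi>"
    by (auto simp: Med_iff)
  then show ?thesis by blast
qed

text \<open>For consistency, a vertex \<open>c\<close> minimizing both remotenesses attains both
  minima at once, so a minimizer of the sum attains each of them separately.\<close>

lemma Med_ABC_function: "ABC_function G (Med G)"
  unfolding ABC_function_def
proof (intro conjI)
  show "Med G \<in> consensus_functions G"
    using Med_nonempty by (auto simp: consensus_functions_def Med_iff)
  show "anonymity G (Med G)"
    by (auto simp: anonymity_def Med_iff)
  show "betweenness G (Med G)"
    unfolding betweenness_def
  proof (intro ballI set_eqI)
    fix u v w
    assume uv: "u \<in> V" "v \<in> V"
    have lb: "d u v \<le> d x u + d x v" if "x \<in> V" for x
      using dist_triangle[of u x v] dist_sym[of u x] that uv by simp
    have "w \<in> Med G [u, v] \<longleftrightarrow> w \<in> V \<and> d w u + d w v = d u v"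
    proof
      assume w: "w \<in> Med G [u, v]"
      then have "remote (mset [u, v]) w \<le> remote (mset [u, v]) u"
        using uv by (simp only: Med_iff)
      then show "w \<in> V \<and> d w u + d w v = d u v"
        using w uv lb[of w] by (simp add: Med_iff)
    qed (use lb in \<open>simp add: Med_iff\<close>)
    then show "w \<in> Med G [u, v] \<longleftrightarrow> w \<in> ginterval G u v"
      using uv dist_sym[of u w] by (auto simp: ginterval_iff)
  qed
  show "consistency G (Med G)"
    unfolding consistency_def
  proof (intro ballI impI)
    fix \<pi> \<rho>
    assume "Med G \<pi> \<inter> Med G \<rho> \<noteq> {}"
    then obtain c where "c \<in> Med G \<pi>" "c \<in> Med G \<rho>"
      by blast
    then have c: "c \<in> V" "\<And>u. u \<in> V \<Longrightarrow> remote (mset \<pi>) c \<le> remote (mset \<pi>) u"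
      "\<And>u. u \<in> V \<Longrightarrow> remote (mset \<rho>) c \<le> remote (mset \<rho>) u"
      by (auto simp: Med_iff)
    show "Med G (\<pi> @ \<rho>) = Med G \<pi> \<inter> Med G \<rho>"
    proof (intro set_eqI iffI)
      fix x
      assume "x \<in> Med G (\<pi> @ \<rho>)"
      then have "x \<in> V" "remote (mset \<pi>) x + remote (mset \<rho>) x \<le> remote (mset \<pi>) c + remote (mset \<rho>) c"
        using c(1) by (auto simp: Med_iff)
      with c(2,3)[of x] have "remote (mset \<pi>) x = remote (mset \<pi>) c" "remote (mset \<rho>) x = remote (mset \<rho>) c"
        by auto
      with c \<open>x \<in> V\<close> show "x \<in> Med G \<pi> \<inter> Med G \<rho>"
        by (auto simp: Med_iff)
    qed (auto simp: Med_iff add_mono)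
  qed
qed

text \<open>Connectedness in the form of an induction: what passes between medians at distance at
  most 2 passes to all medians.\<close>

lemma G2_connected_induct:
  assumes "G2_connected_medians G" "set_mset m \<subseteq> V" "u \<in> med m" "v \<in> med m"
    and P: "P u" "\<And>a b. a \<in> med m \<Longrightarrow> b \<in> med m \<Longrightarrow> d a b \<le> 2 \<Longrightarrow> P a \<Longrightarrow> P b"
  shows "P v"
proof -
  obtain \<pi> where \<pi>: "mset \<pi> = m"
    using ex_mset by blast
  let ?H = "with_proj (graph_square G) \<restriction> med m"
  \<comment> \<open>\<open>connected\<close> refers to the symmetric closure, so reachability is
    taken there.\<close>
  interpret K: pair_wf_digraph "mk_symmetric ?H"
    by unfold_locales (auto simp: parcs_mk_symmetric)
  have "\<pi> \<in> profiles G"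
    using assms(2) \<pi> by auto
  then have "connected ?H"
    using assms(1) \<pi> by (auto simp: G2_connected_medians_def Med_eq_med)
  then have "u \<rightarrow>\<^sup>*\<^bsub>mk_symmetric ?H\<^esub> v"
    using assms(3,4) by (auto simp: connected_def strongly_connected_def)
  then show "P v"
  proof (induction rule: K.reachable_induct)
    case base
    show ?case by (rule P(1))
  next
    case (step a b)
    then have "(a, b) \<in> parcs (mk_symmetric ?H)"
      by simp
    then have "a \<in> med m" "b \<in> med m" "d a b \<le> 2 \<or> d b a \<le> 2" "a \<in> V" "b \<in> V"
      by (auto simp: parcs_mk_symmetric graph_square_def med_def)
    then show ?case
      using step P(2)[of a b] dist_sym[of a b] by auto
  qed
qed

end

section \<open>Modular graphs\<close>

locale modular_connected_graph = connected_graph +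
  assumes modular: "modular_graph G"
begin

lemma median_vertex:
  assumes "x \<in> V" "u \<in> V" "v \<in> V"
  obtains p where "p \<in> V" "d u p + d p v = d u v" "d x u = d x p + d p u" "d x v = d x p + d p v"
proof -
  obtain p where "p \<in> ginterval G u v" "p \<in> ginterval G v x" "p \<in> ginterval G x u"
    using modular assms unfolding modular_graph_def by blast
  then show ?thesis
    using that[of p] assms dist_sym[of p v] dist_sym[of v x] dist_sym[of p x]
    by (simp add: ginterval_iff)
qed

text \<open>The median vertex of \<open>x\<close>, \<open>u\<close>, \<open>v\<close> must be an end
  of the edge, so the distances from \<open>x\<close> to the ends never tie: the graph is
  bipartite.\<close>

lemma edge_dist:
  assumes "x \<in> V" "u \<in> V" "v \<in> V" "d u v = 1"
  shows "d x v = Suc (d x u) \<or> d x u = Suc (d x v)"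
proof -
  obtain p where p: "p \<in> V" "d u p + d p v = d u v" "d x u = d x p + d p u" "d x v = d x p + d p v"
    using median_vertex assms(1-3) by metis
  then have "d u p = 0 \<or> d p v = 0"
    using assms(4) by linarith
  then show ?thesis
    using p assms dist_sym[of u v] by (auto simp: dist_eq_0)
qed

lemma interval_of_dist_2:
  assumes "u \<in> V" "v \<in> V" "p \<in> V" "d u v = 2" "d u p + d p v = 2"
  shows "p = u \<or> p = v \<or> d u p = 1 \<and> d p v = 1"
proof -
  have "d u p = 0 \<or> d p v = 0 \<or> d u p = 1 \<and> d p v = 1"
    using assms(5) by arith
  then show ?thesis
    using assms by (auto simp: dist_eq_0)
qed

text \<open>With a single common neighbour \<open>z\<close>, the median vertex of \<open>x\<close>,
  \<open>u\<close>, \<open>v\<close> would always be \<open>u\<close>, \<open>v\<close> or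
  \<open>z\<close>. Each case gives \<open>2 * d z x \<le> d u x + d v x\<close>, and summing over
  \<open>m\<close> contradicts \<open>strict\<close>.\<close>

lemma two_common_neighbours:
  assumes "set_mset m \<subseteq> V" "u \<in> V" "v \<in> V" "d u v = 2" "remote m u = remote m v"
    and strict: "\<And>z. z \<in> V \<Longrightarrow> d u z = 1 \<Longrightarrow> d z v = 1 \<Longrightarrow> remote m u < remote m z"
  obtains z z' where "z \<in> V" "d u z = 1" "d z v = 1" "z' \<in> V" "d u z' = 1" "d z' v = 1" "z \<noteq> z'"
proof -
  obtain z where "z \<in> V" "d u z = 1" "d u v = 1 + d z v"
    by (rule geodesic_point[of u v 1]) (use assms(2-4) in auto)
  then have z: "z \<in> V" "d u z = 1" "d z v = 1"
    using assms(4) by auto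
  have "\<exists>z'\<in>V. d u z' = 1 \<and> d z' v = 1 \<and> z' \<noteq> z"
  proof (rule ccontr)
    assume unique: "\<not> ?thesis"
    have "2 * d z x \<le> d u x + d v x" if x: "x \<in> V" for x
    proof -
      obtain p where p: "p \<in> V" "d u p + d p v = 2" "d x u = d x p + d p u" "d x v = d x p + d p v"
        by (rule median_vertex[of x u v]) (use assms(2-4) x in auto)
      have sym: "d x u = d u x" "d x v = d v x" "d x z = d z x" "d z u = 1" "d v z = 1"
        "d p u = d u p" "d v u = 2"
        using dist_sym[of x u] dist_sym[of x v] dist_sym[of x z] dist_sym[of z u] dist_sym[of v z]
          dist_sym[of p u] dist_sym[of v u] x assms(2-4) z p(1)
        by simp_all
      have tri: "d x z \<le> d x u + d u z" "d x z \<le> d x v + d v z"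
        using dist_triangle[OF x _ z(1)] assms(2,3) by auto
      consider "p = u" | "p = v" | "p = z"
        using interval_of_dist_2[of u v p] p assms(2-4) unique by auto
      then show ?thesis
      proof cases
        case 1
        show ?thesis
          using p(4) sym(1-3) tri z(2) assms(4) unfolding 1 by linarith
      next
        case 2
        show ?thesis
          using p(3) sym(1-3,5,7) tri unfolding 2 by linarith
      next
        case 3
        show ?thesis
          using p(3,4) sym(1-3) unfolding 3 by linarith
      qed
    qed
    then have "2 * remote m z \<le> remote m u + remote m v"
      using assms(1)
    proof (induction m)
      case (add x m)
      have "2 * d z x \<le> d u x + d v x" "2 * remote m z \<le> remote m u + remote m v"
        using add by auto
      then show ?case by simp
    qed simp
    then show False
      using strict[OF z] assms(5) by simp
  qed
  then show ?thesis
    using that z by blast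
qed

text \<open>Otherwise take a closest better vertex \<open>v\<close>. A modified profile has both
  \<open>u\<close> and \<open>v\<close> as medians but no other median within distance 2 of
  \<open>u\<close>, against connectedness.\<close>

lemma local_median_is_median:
  assumes G2: "G2_connected_medians G" and m: "set_mset m \<subseteq> V" and u: "u \<in> V"
    and loc: "\<And>v. v \<in> V \<Longrightarrow> d u v \<le> 2 \<Longrightarrow> remote m u \<le> remote m v"
  shows "u \<in> med m"
proof (rule ccontr)
  assume "u \<notin> med m"
  then have "\<exists>v. v \<in> V \<and> remote m v < remote m u"
    using u by (auto simp: med_def not_le)
  then obtain v where v: "v \<in> V" "remote m v < remote m u"
    and closest: "\<And>w. w \<in> V \<Longrightarrow> remote m w < remote m u \<Longrightarrow> d u v \<le> d u w"
    using ex_has_least_nat[of "\<lambda>v. v \<in> V \<and> remote m v < remote m u" _ "d u"] by blast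
  define k where "k = d u v"
  define q where "q = remote m u - remote m v"
  define N where "N = k * size m + q"
  \<comment> \<open>The copies of \<open>u\<close> compensate the advantage of \<open>v\<close>, those of \<open>{u, v}\<close> confine the medians
    to the interval between \<open>u\<close> and \<open>v\<close>.\<close>
  define n where "n = repeat_mset k m + repeat_mset N {#u, v#} + replicate_mset q u"
  have q: "remote m u = remote m v + q" "q > 0"
    using v by (auto simp: q_def)
  have vu: "d v u = k"
    using u v dist_sym[of v u] k_def by simp
  have n: "remote n w = k * remote m w + N * (d w u + d w v) + q * d w u" for w
    by (simp add: n_def algebra_simps)
  have nV: "set_mset n \<subseteq> V"
    using m u v by (auto simp: n_def dest: in_repeat_msetD)
  have nu: "remote n u = k * remote m u + N * k"
    using u by (simp add: n k_def)
  \<comment> \<open>\<open>v\<close> gains \<open>k * q\<close> on the copies of \<open>m\<close>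
    and loses \<open>q * d v u\<close> on those of \<open>u\<close>; the two balance.\<close>
  have nv: "remote n v = remote n u"
    unfolding nu using v vu by (simp add: n q algebra_simps)
  have interval: "remote n u \<le> remote n p" if p: "p \<in> V" "d u p + d p v = k" for p
  proof (cases "d p v = 0")
    case True
    then show ?thesis using p v nv by (simp add: dist_eq_0)
  next
    case False
    then have "\<not> remote m p < remote m u"
      using closest[of p] p k_def by auto
    then have "k * remote m u \<le> k * remote m p"
      by simp
    moreover have pk: "d p u + d p v = k"
      using p u dist_sym[of p u] by simp
    ultimately show ?thesis
      unfolding nu n[of p] pk by linarith
  qed
  \<comment> \<open>Moving \<open>w\<close> to the point \<open>p\<close> of the interval saves
    \<open>2 * d w p\<close> on each of the \<open>N\<close> pairs, which outweighs the Lipschitz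
    loss on the copies of \<open>m\<close>.\<close>
  have le: "remote n u \<le> remote n w" if w: "w \<in> V" for w
  proof -
    obtain p where p: "p \<in> V" "d u p + d p v = k" "d w u = d w p + d p u" "d w v = d w p + d p v"
      by (rule median_vertex[of w u v]) (use u v w k_def in auto)
    have "remote m p \<le> remote m w + size m * d w p"
      using remote_Lipschitz[OF m, of p w] p w dist_sym[of p w] by simp
    then have "k * remote m p \<le> k * (remote m w + size m * d w p)"
      by (rule mult_le_mono2)
    then have "remote n p \<le> remote n w"
      by (simp add: n p N_def algebra_simps)
    then show ?thesis
      using interval[of p] p by simp
  qed
  have med: "u \<in> med n" "v \<in> med n"
    using le nv u v by (auto simp: med_def)
  have "v = u"
  proof (rule G2_connected_induct[OF G2 nV med, of "\<lambda>x. x = u"])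
    fix a b
    assume b: "b \<in> med n" "d a b \<le> 2" "a = u"
    then have bV: "b \<in> V" "remote n b \<le> remote n u"
      using u by (auto simp: med_def)
    have "remote m u \<le> remote m b"
      using loc bV b by auto
    then have "k * remote m u \<le> k * remote m b"
      by simp
    moreover have "k \<le> d b u + d b v"
      using dist_triangle[of u b v] dist_sym[of u b] u v bV k_def by simp
    then have "N * k \<le> N * (d b u + d b v)"
      by (rule mult_le_mono2)
    ultimately have "q * d b u = 0"
      using bV(2) by (simp only: n[of b] nu)
    then show "b = u"
      using q bV u by (simp add: dist_eq_0)
  qed simp
  then show False
    using v by simp
qed

end

section \<open>Consensus functions on modular graphs\<close>

locale ABC_consensus = modular_connected_graph +
  fixes L :: "'a list \<Rightarrow> 'a set"
  assumes ABC: "ABC_function G L"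
begin

text \<open>By anonymity, \<open>L\<close> may be regarded as a function of multisets.\<close>

definition cons :: "'a multiset \<Rightarrow> 'a set" where
  "cons m = L (SOME \<pi>. mset \<pi> = m)"

lemma cons_mset:
  assumes "set \<pi> \<subseteq> V"
  shows "cons (mset \<pi>) = L \<pi>"
proof -
  let ?\<rho> = "SOME \<rho>. mset \<rho> = mset \<pi>"
  have eq: "mset ?\<rho> = mset \<pi>"
    by (rule someI[of _ \<pi>]) simp
  then have "set ?\<rho> = set \<pi>"
    by (rule mset_eq_setD)
  then show ?thesis
    using ABC eq assms by (simp add: cons_def ABC_function_def anonymity_def in_lists_conv_set subset_iff)
qed

lemma cons_nonempty: "set_mset m \<subseteq> V \<Longrightarrow> cons m \<noteq> {}"
  and cons_subset: "set_mset m \<subseteq> V \<Longrightarrow> cons m \<subseteq> V"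
proof -
  obtain \<pi> where \<pi>: "mset \<pi> = m"
    using ex_mset by blast
  have *: "L \<pi> \<subseteq> V \<and> L \<pi> \<noteq> {}" if "set_mset m \<subseteq> V"
  proof -
    have "\<pi> \<in> profiles G"
      using that \<pi> by auto
    then have "L \<pi> \<in> Pow V - {{}}"
      using ABC unfolding ABC_function_def consensus_functions_def by blast
    then show ?thesis by blast
  qed
  show "set_mset m \<subseteq> V \<Longrightarrow> cons m \<noteq> {}" "set_mset m \<subseteq> V \<Longrightarrow> cons m \<subseteq> V"
    using * \<pi> cons_mset[of \<pi>] by auto
qed

lemma cons_pair:
  assumes "u \<in> V" "v \<in> V"
  shows "cons {#u, v#} = ginterval G u v"
  using cons_mset[of "[u, v]"] ABC assms by (simp add: ABC_function_def betweenness_def)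

lemma cons_add:
  assumes "set_mset m \<subseteq> V" "set_mset n \<subseteq> V" "p \<in> cons m" "p \<in> cons n"
  shows "cons (m + n) = cons m \<inter> cons n"
proof -
  obtain \<pi> \<rho> where mn: "mset \<pi> = m" "mset \<rho> = n"
    using ex_mset by metis
  then have sets: "set \<pi> \<subseteq> V" "set \<rho> \<subseteq> V"
    using assms(1,2) by auto
  then have "\<pi> \<in> profiles G" "\<rho> \<in> profiles G"
    by auto
  moreover have L: "cons m = L \<pi>" "cons n = L \<rho>" "cons (m + n) = L (\<pi> @ \<rho>)"
    using cons_mset[of \<pi>] cons_mset[of \<rho>] cons_mset[of "\<pi> @ \<rho>"] sets mn by simp_all
  moreover have "L \<pi> \<inter> L \<rho> \<noteq> {}"
    using assms(3,4) L by blast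
  moreover have "consistency G L"
    using ABC by (simp add: ABC_function_def)
  ultimately show ?thesis
    by (simp add: consistency_def)
qed

text \<open>Adding the empty profile to the pair \<open>p\<close>, \<open>v\<close> changes nothing,
  so consistency puts the whole interval, and with it \<open>v\<close>, into the consensus of the
  empty profile.\<close>

lemma cons_empty: "cons {#} = V"
proof -
  obtain p where p: "p \<in> cons {#}" "p \<in> V"
    using cons_nonempty[of "{#}"] cons_subset[of "{#}"] by auto
  have "v \<in> cons {#}" if v: "v \<in> V" for v
  proof -
    have "p \<in> cons {#p, v#}" "v \<in> cons {#p, v#}"
      using p v by (simp_all add: cons_pair ginterval_iff)
    then show ?thesis
      using cons_add[of "{#}" "{#p, v#}" p] p v by auto
  qed
  then show ?thesis
    using cons_subset[of "{#}"] by auto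
qed

lemma cons_repeat:
  assumes "set_mset m \<subseteq> V" "p \<in> cons m"
  shows "cons (repeat_mset (Suc k) m) = cons m"
proof (induction k)
  case (Suc k)
  have "set_mset (repeat_mset (Suc k) m) \<subseteq> V"
    using assms(1) in_repeat_msetD by fast
  then show ?case
    using Suc assms cons_add[of m "repeat_mset (Suc k) m" p] by simp
qed simp

text \<open>Zero copies are covered by \<open>cons_empty\<close>; this matters because
  multiplicities below may vanish.\<close>

lemma in_cons_repeat:
  assumes "set_mset m \<subseteq> V" "p \<in> cons m"
  shows "p \<in> cons (repeat_mset k m)"
proof (cases k)
  case 0
  then show ?thesis
    using cons_subset[OF assms(1)] assms(2) cons_empty by auto
next
  case (Suc j)
  then show ?thesis
    using cons_repeat[OF assms, of j] assms(2) by simp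
qed

text \<open>Consistency allows doubling the profile, and betweenness settles the pair
  \<open>u\<close>, \<open>u\<close>.\<close>

lemma cons_single:
  assumes "u \<in> V"
  shows "cons {#u#} = {u}"
proof -
  obtain p where "p \<in> cons {#u#}"
    using cons_nonempty[of "{#u#}"] assms by auto
  then have "cons ({#u#} + {#u#}) = cons {#u#}"
    using cons_add[of "{#u#}" "{#u#}" p] assms by simp
  then show ?thesis
    using cons_pair[OF assms assms] interval_self[OF assms] by simp
qed

lemma replicate_eq_repeat: "replicate_mset k u = repeat_mset k {#u#}"
  by (induction k) simp_all

lemma cons_replicate:
  assumes "u \<in> V" "k > 0"
  shows "cons (replicate_mset k u) = {u}"
proof -
  obtain j where "k = Suc j"
    using assms(2) by (cases k) auto
  then show ?thesis
    using cons_repeat[of "{#u#}" u j] assms(1) cons_single[of u]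
    by (simp only: replicate_eq_repeat) simp
qed

text \<open>
  For an edge \<open>uv\<close> every profile can be completed by copies of \<open>u\<close> and \<open>v\<close> to a sum of pairs whose
  intervals contain both \<open>u\<close> and \<open>v\<close>.
\<close>

lemma edge_completion:
  assumes "u \<in> V" "v \<in> V" "d u v = 1" "set_mset m \<subseteq> V"
  shows "\<exists>a b. u \<in> cons (m + (replicate_mset a v + replicate_mset b u)) \<and>
               v \<in> cons (m + (replicate_mset a v + replicate_mset b u)) \<and>
               remote m v + b = remote m u + a"
  using assms(4)
proof (induction m)
  case empty
  then show ?case
    using assms cons_empty by (intro exI[of _ 0]) simp
next
  case (add x m)
  then obtain a b where ab: "u \<in> cons (m + (replicate_mset a v + replicate_mset b u))"
    "v \<in> cons (m + (replicate_mset a v + replicate_mset b u))" "remote m v + b = remote m u + a"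
    by auto
  let ?n = "m + (replicate_mset a v + replicate_mset b u)"
  have x: "x \<in> V" and nV: "set_mset ?n \<subseteq> V"
    using add.prems assms by (auto split: if_splits)
  have sym: "d x u = d u x" "d x v = d v x" "d v u = 1"
    using dist_sym[of x u] dist_sym[of x v] dist_sym[of u v] x assms by auto
  from edge_dist[OF x assms(1-3)] show ?case
  proof
    \<comment> \<open>Pairing \<open>x\<close> with the farther end \<open>v\<close> puts
      \<open>u\<close> between them; the extra copy of \<open>v\<close> matches the unit by which
      \<open>x\<close> is farther from \<open>v\<close>.\<close>
    assume closer: "d x v = Suc (d x u)"
    have "u \<in> cons {#x, v#}" "v \<in> cons {#x, v#}"
      using x assms closer by (simp_all add: cons_pair ginterval_iff)
    then have *: "u \<in> cons ({#x, v#} + ?n)" "v \<in> cons ({#x, v#} + ?n)"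
      using cons_add[of "{#x, v#}" ?n u] x assms nV ab by auto
    have eq: "add_mset x m + (replicate_mset (Suc a) v + replicate_mset b u) = {#x, v#} + ?n"
      by simp
    have "remote (add_mset x m) v + b = remote (add_mset x m) u + Suc a"
      using ab(3) sym closer by simp
    then show ?thesis
      using * unfolding eq[symmetric] by blast
  next
    assume closer: "d x u = Suc (d x v)"
    have "u \<in> cons {#x, u#}" "v \<in> cons {#x, u#}"
      using x assms sym closer by (simp_all add: cons_pair ginterval_iff)
    then have *: "u \<in> cons ({#x, u#} + ?n)" "v \<in> cons ({#x, u#} + ?n)"
      using cons_add[of "{#x, u#}" ?n u] x assms nV ab by auto
    have eq: "add_mset x m + (replicate_mset a v + replicate_mset (Suc b) u) = {#x, u#} + ?n"
      by simp
    have "remote (add_mset x m) v + Suc b = remote (add_mset x m) u + a"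
      using ab(3) sym closer by simp
    then show ?thesis
      using * unfolding eq[symmetric] by blast
  qed
qed

lemma replicate_pair:
  "replicate_mset a v + replicate_mset (a + c) u = repeat_mset a {#u, v#} + replicate_mset c u"
  by (rule multiset_eqI) simp

text \<open>If \<open>v\<close> were better, the completion would contain more copies of
  \<open>u\<close> than of \<open>v\<close>. The surplus reduces the consensus to
  \<open>{u}\<close>, although the completion has \<open>v\<close> in it.\<close>

lemma edge_remote_le:
  assumes "u \<in> V" "v \<in> V" "d u v = 1" "set_mset m \<subseteq> V" "u \<in> cons m"
  shows "remote m u \<le> remote m v"
proof (rule ccontr)
  assume lt: "\<not> ?thesis"
  obtain a b where ab: "v \<in> cons (m + (replicate_mset a v + replicate_mset b u))"
    "remote m v + b = remote m u + a"
    using edge_completion[OF assms(1-4)] by blast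
  define c where "c = b - a"
  have c: "b = a + c" "c > 0"
    using ab(2) lt by (auto simp: c_def)
  let ?n = "repeat_mset a {#u, v#}" and ?r = "replicate_mset c u"
  have sets: "set_mset ?n \<subseteq> V" "set_mset ?r \<subseteq> V"
    using assms(1,2) by (auto dest!: in_repeat_msetD)
  have "u \<in> cons ?n"
    using in_cons_repeat[of "{#u, v#}" u a] assms(1,2) by (simp add: cons_pair ginterval_iff)
  then have "cons (?n + ?r) = {u}"
    using cons_add[OF sets, of u] cons_replicate[OF assms(1) c(2)] by auto
  then have "cons (m + (?n + ?r)) = {u}"
    using cons_add[of m "?n + ?r" u] assms(4,5) sets by auto
  then have "v = u"
    using ab(1) unfolding c(1) replicate_pair by simp
  then show False
    using assms(2,3) by simp
qed

text \<open>For equal remoteness the completion consists of whole pairs \<open>u\<close>,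
  \<open>v\<close>, and consistency at \<open>u\<close> passes \<open>v\<close> back to
  \<open>m\<close>.\<close>

lemma edge_cons:
  assumes "u \<in> V" "v \<in> V" "d u v = 1" "set_mset m \<subseteq> V" "u \<in> cons m" "remote m u = remote m v"
  shows "v \<in> cons m"
proof -
  obtain a b where ab: "v \<in> cons (m + (replicate_mset a v + replicate_mset b u))"
    "remote m v + b = remote m u + a"
    using edge_completion[OF assms(1-4)] by blast
  let ?n = "repeat_mset a {#u, v#}"
  have "b = a"
    using ab(2) assms(6) by simp
  then have "replicate_mset a v + replicate_mset b u = ?n"
    by (simp add: ac_simps)
  then have "v \<in> cons (m + ?n)"
    using ab(1) by (simp only:)
  moreover have "u \<in> cons ?n"
    using in_cons_repeat[of "{#u, v#}" u a] assms(1,2) by (simp add: cons_pair ginterval_iff)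
  moreover have "set_mset ?n \<subseteq> V"
    using assms(1,2) by (auto dest!: in_repeat_msetD)
  ultimately show ?thesis
    using cons_add[of m ?n u] assms(4,5) by auto
qed

text \<open>
  The copies of \<open>z\<close> make \<open>z\<close> as good as \<open>u\<close> and \<open>v\<close>, so that the edge lemmas link all three, and
  the copies of \<open>{u, v}\<close> keep other vertices out of the consensus.
\<close>

lemma balanced_neighbour:
  assumes "u \<in> V" "v \<in> V" "d u v = 2" "set_mset m \<subseteq> V" "remote m u = remote m v"
    and z: "z \<in> V" "d u z = 1" "d z v = 1" "remote m z = remote m u + t"
    and strict: "\<And>z. z \<in> V \<Longrightarrow> d u z = 1 \<Longrightarrow> d z v = 1 \<Longrightarrow> remote m u < remote m z"
  defines "n \<equiv> m + repeat_mset (Suc (size m + t)) {#u, v#} + replicate_mset t z"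
  shows "u \<in> cons n" "v \<in> cons n"
proof -
  define N where "N = Suc (size m + t)"
  have sym: "d v u = 2" "d z u = 1" "d v z = 1"
    using dist_sym[of u v] dist_sym[of u z] dist_sym[of z v] assms(1-3) z by auto
  have nV: "set_mset n \<subseteq> V"
    using assms(1,2,4) z by (auto simp: n_def dest!: in_repeat_msetD split: if_splits)
  have n: "remote n w = remote m w + N * (d w u + d w v) + t * d w z" for w
    unfolding n_def N_def[symmetric] by (simp add: algebra_simps)
  have eq: "remote n u = remote n z" "remote n v = remote n z"
    unfolding n using assms(1-5) z sym by simp_all
  obtain y where y: "y \<in> cons n"
    using cons_nonempty[OF nV] by blast
  then have yV: "y \<in> V"
    using cons_subset[OF nV] by blast
  obtain p where p: "p \<in> V" "d u p + d p v = d u v" "d y u = d y p + d p u" "d y v = d y p + d p v"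
    using median_vertex[OF yV assms(1,2)] by blast
  \<comment> \<open>A step from \<open>y\<close> towards \<open>p\<close> saves \<open>2 * N\<close>
    on the pairs, more than the at most \<open>size m + t\<close> it can cost elsewhere.\<close>
  have "y = p"
  proof (rule ccontr)
    assume "y \<noteq> p"
    then obtain x where x: "x \<in> V" "d y x = 1" "d y p = Suc (d x p)"
      using geodesic_step[OF yV p(1)] by metis
    have "remote n y \<le> remote n x"
      using edge_remote_le[OF yV x(1,2) nV y] .
    moreover have xy: "d x y = 1"
      using x dist_sym[of x y] yV by simp
    then have "remote m x \<le> remote m y + size m"
      using remote_Lipschitz[OF assms(4) x(1) yV] by simp
    moreover have "d x z \<le> d y z + 1"
      using dist_triangle[OF x(1) yV z(1)] xy by simp
    then have "t * d x z \<le> t * (d y z + 1)"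
      by (rule mult_le_mono2)
    moreover have "d x u + d x v + 2 \<le> d y u + d y v"
      using dist_triangle[OF x(1) p(1) assms(1)] dist_triangle[OF x(1) p(1) assms(2)] p x by simp
    then have "N * (d x u + d x v + 2) \<le> N * (d y u + d y v)"
      by (rule mult_le_mono2)
    moreover have "size m + t < 2 * N"
      by (simp add: N_def)
    ultimately show False
      unfolding n by (simp add: distrib_left)
  qed
  then have "y = u \<or> y = v \<or> d u y = 1 \<and> d y v = 1"
    using interval_of_dist_2[of u v y] assms(1-3) p by simp
  \<comment> \<open>Any other common neighbour pays at least \<open>t\<close> to the copies of
    \<open>z\<close>, and so is strictly worse than \<open>u\<close>.\<close>
  moreover have "y = z" if yn: "d u y = 1" "d y v = 1"
  proof (rule ccontr)
    assume "y \<noteq> z"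
    then have "d y z \<ge> 1"
      using dist_eq_0[OF yV z(1)] by (simp add: Suc_leI)
    then have "t \<le> t * d y z"
      by simp
    moreover have yu: "d y u = 1"
      using yn dist_sym[of y u] yV assms(1) by simp
    then have "remote n y \<le> remote n u"
      using edge_remote_le[OF yV assms(1) _ nV y] by simp
    then have "remote m y + t * d y z \<le> remote m u + t"
      using yn yu assms(1,3) z(2) unfolding n by simp
    ultimately show False
      using strict[OF yV yn] by linarith
  qed
  ultimately consider "y = u" | "y = v" | "y = z"
    by blast
  \<comment> \<open>As \<open>u\<close>, \<open>v\<close> and \<open>z\<close> tie,
    \<open>edge_cons\<close> carries membership from any of them to \<open>z\<close>, and from there
    to both ends.\<close>
  then have zc: "z \<in> cons n"
    using edge_cons[OF assms(1) z(1,2) nV] edge_cons[OF assms(2) z(1) sym(3) nV] eq y by cases simp_all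
  show "u \<in> cons n" "v \<in> cons n"
    using edge_cons[OF z(1) assms(1) sym(2) nV zc] edge_cons[OF z(1) assms(2) z(3) nV zc] eq
    by simp_all
qed

text \<open>A common neighbour tied with \<open>u\<close> reduces the claim to two edges; otherwise
  two balanced profiles are combined.\<close>

lemma dist_2_cons:
  assumes "u \<in> V" "v \<in> V" "d u v = 2" "set_mset m \<subseteq> V" "u \<in> cons m" "remote m u = remote m v"
    and le: "\<And>z. z \<in> V \<Longrightarrow> d u z = 1 \<Longrightarrow> d z v = 1 \<Longrightarrow> remote m u \<le> remote m z"
  shows "v \<in> cons m"
proof (cases "\<exists>z\<in>V. d u z = 1 \<and> d z v = 1 \<and> remote m u = remote m z")
  case True
  then obtain z where z: "z \<in> V" "d u z = 1" "d z v = 1" "remote m u = remote m z"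
    by blast
  then have "z \<in> cons m"
    using edge_cons[OF assms(1) z(1,2) assms(4,5)] by simp
  then show ?thesis
    using edge_cons[OF z(1) assms(2) z(3) assms(4)] z(4) assms(6) by simp
next
  case False
  then have strict: "remote m u < remote m z" if "z \<in> V" "d u z = 1" "d z v = 1" for z
    using le[OF that] that by (metis le_neq_implies_less)
  obtain z z' where z: "z \<in> V" "d u z = 1" "d z v = 1"
    and z': "z' \<in> V" "d u z' = 1" "d z' v = 1" and "z \<noteq> z'"
    using two_common_neighbours[OF assms(4,1-3,6)] strict by metis
  define t where "t = remote m z - remote m u"
  define t' where "t' = remote m z' - remote m u"
  have t: "remote m z = remote m u + t" "t > 0" and t': "remote m z' = remote m u + t'" "t' > 0"
    using strict[OF z] strict[OF z'] by (auto simp: t_def t'_def)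
  let ?N = "Suc (size m + t)" and ?N' = "Suc (size m + t')"
  let ?n = "m + repeat_mset ?N {#u, v#} + replicate_mset t z"
  let ?n' = "m + repeat_mset ?N' {#u, v#} + replicate_mset t' z'"
  have n: "u \<in> cons ?n" "v \<in> cons ?n" "u \<in> cons ?n'" "v \<in> cons ?n'"
    using balanced_neighbour[OF assms(1-4,6) z t(1) strict]
      balanced_neighbour[OF assms(1-4,6) z' t'(1) strict] by blast+
  have nV: "set_mset ?n \<subseteq> V" "set_mset ?n' \<subseteq> V"
    using assms(1,2,4) z(1) z'(1) by (auto dest!: in_repeat_msetD split: if_splits)
  let ?K = "t' * ?N + t * ?N'"
  \<comment> \<open>The multiplicities make \<open>z\<close> and \<open>z'\<close> occur equally
    often, \<open>t * t'\<close> times, so that they can be paired.\<close>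
  have eq: "repeat_mset t' ?n + repeat_mset t ?n' =
      repeat_mset (t + t') m + (repeat_mset ?K {#u, v#} + repeat_mset (t * t') {#z, z'#})"
    (is "_ = ?A + (?B + ?C)")
    by (rule multiset_eqI) (simp add: algebra_simps)
  have repV: "set_mset (repeat_mset k l) \<subseteq> V" if "set_mset l \<subseteq> V" for k l
    using that in_repeat_msetD by fast
  have "v \<in> cons (repeat_mset t' ?n)" "v \<in> cons (repeat_mset t ?n')"
    using in_cons_repeat nV n by blast+
  then have v: "v \<in> cons (?A + (?B + ?C))"
    using cons_add[of "repeat_mset t' ?n" "repeat_mset t ?n'" v] repV[OF nV(1)] repV[OF nV(2)]
    unfolding eq by blast
  \<comment> \<open>Two distinct neighbours of \<open>u\<close> are not adjacent, by
    \<open>edge_dist\<close>; hence \<open>u\<close> lies between them.\<close>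
  have "d z z' = 2"
  proof -
    have "d z u = 1"
      using dist_sym[of z u] z assms(1) by simp
    moreover from this have "d z z' = Suc (d z u) \<or> d z u = Suc (d z z')"
      using edge_dist[OF z(1) assms(1) z'(1,2)] by simp
    moreover have "d z z' \<noteq> 0"
      using \<open>z \<noteq> z'\<close> z z' by (simp add: dist_eq_0)
    ultimately show ?thesis by simp
  qed
  then have "u \<in> cons {#z, z'#}"
    using z z' assms(1) dist_sym[of z u] by (simp add: cons_pair ginterval_iff)
  moreover have "u \<in> cons {#u, v#}"
    using assms(1,2) by (simp add: cons_pair ginterval_iff)
  ultimately have u: "u \<in> cons ?A" "u \<in> cons ?B" "u \<in> cons ?C"
    using assms in_cons_repeat[of m u] in_cons_repeat[of "{#u, v#}" u]
      in_cons_repeat[of "{#z, z'#}" u] z(1) z'(1) by auto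
  have sets: "set_mset ?A \<subseteq> V" "set_mset ?B \<subseteq> V" "set_mset ?C \<subseteq> V"
    by (rule repV, use assms z z' in simp)+
  have "u \<in> cons (?B + ?C)"
    using cons_add[OF sets(2,3) u(2,3)] u by blast
  then have "v \<in> cons ?A"
    using cons_add[of ?A "?B + ?C" u] sets u v by auto
  then show ?thesis
    using cons_repeat[OF assms(4,5), of "t + t' - 1"] t(2) by simp
qed

text \<open>Otherwise \<open>q\<close> copies of \<open>u\<close> added to the doubled profile tie
  \<open>u\<close> with \<open>v\<close>, each copy costing \<open>v\<close> exactly 2. The
  consensus is then \<open>{u}\<close>, yet \<open>dist_2_cons\<close> puts \<open>v\<close> into
  it.\<close>

lemma dist_2_remote_le:
  assumes "u \<in> V" "v \<in> V" "d u v = 2" "set_mset m \<subseteq> V" "u \<in> cons m"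
  shows "remote m u \<le> remote m v"
proof (rule ccontr)
  assume lt: "\<not> ?thesis"
  define q where "q = remote m u - remote m v"
  have q: "remote m u = remote m v + q" "q > 0"
    using lt by (auto simp: q_def)
  define n where "n = (m + m) + replicate_mset q u"
  have nV: "set_mset (m + m) \<subseteq> V" "set_mset (replicate_mset q u) \<subseteq> V" "set_mset n \<subseteq> V"
    using assms by (auto simp: n_def split: if_splits)
  have "u \<in> cons (m + m)"
    using cons_add[OF assms(4,4,5,5)] assms(5) by simp
  then have n: "cons n = {u}"
    using cons_add[OF nV(1,2), of u] cons_replicate[OF assms(1) q(2)] by (simp add: n_def)
  have vu: "d v u = 2"
    using assms dist_sym[of u v] by simp
  have "v \<in> cons n"
  proof (rule dist_2_cons[OF assms(1-3) nV(3)])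
    show "remote n u = remote n v"
      using assms(1) vu q by (simp add: n_def)
    show "remote n u \<le> remote n z" if "z \<in> V" "d u z = 1" for z
      using edge_remote_le[OF assms(1) that nV(3)] n by simp
  qed (simp add: n)
  then show False
    using n assms by simp
qed

lemma cons_eq_med:
  assumes G2: "G2_connected_medians G" and m: "set_mset m \<subseteq> V"
  shows "cons m = med m"
proof -
  have le: "remote m u \<le> remote m v" if uv: "u \<in> cons m" "v \<in> V" "d u v \<le> 2" for u v
  proof -
    have u: "u \<in> V"
      using cons_subset[OF m] uv by blast
    consider "d u v = 0" | "d u v = 1" | "d u v = 2"
      using uv(3) by linarith
    then show ?thesis
      using dist_eq_0[OF u uv(2)] edge_remote_le[OF u uv(2) _ m uv(1)]
        dist_2_remote_le[OF u uv(2) _ m uv(1)] by cases auto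
  qed
  have sub: "cons m \<subseteq> med m"
    using local_median_is_median[OF G2 m] le cons_subset[OF m] by blast
  moreover obtain u where u: "u \<in> cons m"
    using cons_nonempty[OF m] by blast
  moreover have "v \<in> cons m" if v: "v \<in> med m" for v
  proof (rule G2_connected_induct[OF G2 m, of u v "\<lambda>x. x \<in> cons m"])
    fix a b
    assume ab: "a \<in> med m" "b \<in> med m" "d a b \<le> 2" and a: "a \<in> cons m"
    then have V: "a \<in> V" "b \<in> V" and eq: "remote m a = remote m b"
      by (auto simp: med_def intro: order_antisym)
    consider "d a b = 0" | "d a b = 1" | "d a b = 2"
      using ab(3) by linarith
    then show "b \<in> cons m"
    proof cases
      case 1
      then show ?thesis using V a by (simp add: dist_eq_0)
    next
      case 2
      then show ?thesis using edge_cons[OF V _ m a eq] by simp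
    next
      case 3
      then show ?thesis
        using dist_2_cons[OF V 3 m a eq] ab(1) by (simp add: med_def)
    qed
  qed (use u v sub in auto)
  ultimately show ?thesis by blast
qed

end

lemma (in modular_connected_graph) ABC_graph:
  assumes "G2_connected_medians G"
  shows "ABC_graph G"
  unfolding ABC_graph_def
proof (intro conjI allI impI ballI)
  fix L \<pi>
  assume "ABC_function G L" and \<pi>: "\<pi> \<in> profiles G"
  then interpret ABC_consensus G L
    by unfold_locales
  have "set \<pi> \<subseteq> V"
    using \<pi> by auto
  then show "L \<pi> = Med G \<pi>"
    using cons_mset[of \<pi>] cons_eq_med[OF assms, of "mset \<pi>"] by (simp add: Med_eq_med)
qed (rule Med_ABC_function)

section \<open>Bipartite Helly graphs\<close>

locale Helly_graph = connected_graph +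
  fixes X Y :: "'a set"
  assumes bip: "bipartition G X Y" and Helly: "Helly_property (half_balls G X Y)"
begin

lemma even_dist:
  assumes "u \<in> V" "v \<in> V"
  shows "even (d u v) \<longleftrightarrow> (u \<in> X \<longleftrightarrow> v \<in> X)"
  using assms(1)
proof (induction "d u v" arbitrary: u)
  case 0
  then show ?case using assms(2) by (simp add: dist_eq_0)
next
  case (Suc k)
  then have "u \<noteq> v"
    using assms(2) by auto
  then obtain w where w: "w \<in> V" "(u, w) \<in> parcs G" "d u v = Suc (d w v)"
    using geodesic_step[OF Suc.prems assms(2)] by metis
  then have "u \<in> X \<longleftrightarrow> w \<notin> X"
    using bip by (auto simp: bipartition_def)
  then show ?case
    using Suc.hyps(1)[of w] Suc.hyps(2) w by auto
qed

text \<open>All half-balls are taken in the colour class of \<open>p\<close>. By parity, vertices at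
  distance exactly \<open>r a\<close> from \<open>a\<close> lie in that class, so the usual
  condition on radii makes two half-balls meet.\<close>

lemma balls_intersect:
  assumes p: "p \<in> V" and A: "finite A" "A \<noteq> {}" "A \<subseteq> V"
    and parity: "\<And>a. a \<in> A \<Longrightarrow> even (r a + d a p)"
    and pairs: "\<And>a b. a \<in> A \<Longrightarrow> b \<in> A \<Longrightarrow> d a b \<le> r a + r b"
  obtains w where "w \<in> V" "\<And>a. a \<in> A \<Longrightarrow> d a w \<le> r a"
proof -
  define C where "C = (if p \<in> X then X else Y)"
  have C: "w \<in> C \<longleftrightarrow> even (d w p)" if "w \<in> V" for w
    using even_dist[OF that p] bip that by (auto simp: C_def bipartition_def)
  define H where "H a = gball G (r a) a \<inter> C" for a
  have H: "w \<in> H a \<longleftrightarrow> w \<in> V \<and> d a w \<le> r a \<and> even (d w p)" for w a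
    using C by (auto simp: H_def gball_def)
  have sub: "H ` A \<subseteq> half_balls G X Y"
    using A(3) by (auto simp: H_def C_def half_balls_def)
  have "H a \<inter> H b \<noteq> {}" if ab: "a \<in> A" "b \<in> A" for a b
  proof -
    have V: "a \<in> V" "b \<in> V"
      using ab A(3) by auto
    have "\<exists>w\<in>V. d a w \<le> r a \<and> d b w \<le> r b \<and> even (d w p)"
    proof (cases "r a \<le> d a b")
      case True
      obtain w where w: "w \<in> V" "d a w = r a" "d a b = r a + d w b"
        using geodesic_point[OF V True] .
      then have "d b w \<le> r b"
        using pairs[OF ab] dist_sym[OF V(2) w(1)] by simp
      moreover have "even (d w p)"
        using parity[OF ab(1)] even_dist[OF V(1) w(1)] even_dist[OF V(1) p] even_dist[OF w(1) p] w(2)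
        by auto
      ultimately show ?thesis
        using w(1,2) by (intro bexI[of _ w]) simp_all
    next
      case False
      \<comment> \<open>Here \<open>b\<close> lies in the interior of the ball about
        \<open>a\<close>. If \<open>b\<close> has the wrong colour, then \<open>r b\<close> is odd,
        hence positive, and a neighbour of \<open>b\<close> serves.\<close>
      show ?thesis
      proof (cases "even (d b p)")
        case True
        then show ?thesis
          using False V by (intro bexI[of _ b]) auto
      next
        case odd: False
        then have "b \<noteq> p"
          using p by auto
        then obtain w where w: "w \<in> V" "d b w = 1" "d b p = Suc (d w p)"
          using geodesic_step[OF V(2) p] by metis
        have "odd (r b)"
          using parity[OF ab(2)] odd by simp
        then have "d b w \<le> r b"
          using w(2) by (cases "r b") auto
        moreover have "d a w \<le> r a"
          using dist_triangle[OF V w(1)] w(2) False by simp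
        ultimately show ?thesis
          using w(1,3) odd by (intro bexI[of _ w]) simp_all
      qed
    qed
    then show ?thesis
      using H by blast
  qed
  then have "\<forall>B\<in>H ` A. \<forall>C\<in>H ` A. B \<inter> C \<noteq> {}"
    by simp
  moreover have "finite (H ` A)"
    using A(1) by simp
  ultimately have "\<Inter>(H ` A) \<noteq> {}"
    using Helly sub unfolding Helly_property_def by meson
  then obtain w where w: "\<And>a. a \<in> A \<Longrightarrow> w \<in> H a"
    by auto
  then show ?thesis
    using that[of w] A(2) H by blast
qed

text \<open>A common point of the three balls with these radii forces equality in three triangle
  inequalities, so it lies in all three intervals.\<close>

lemma Helly_modular: "modular_graph G"
  unfolding modular_graph_def
proof (intro ballI)
  fix x y z
  assume V: "x \<in> V" "y \<in> V" "z \<in> V"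
  have sym: "d y x = d x y" "d z y = d y z" "d z x = d x z"
    using dist_sym V by blast+
  have tri: "d x y \<le> d x z + d y z" "d y z \<le> d x y + d x z" "d x z \<le> d x y + d y z"
    using dist_triangle[OF V(1,3,2)] dist_triangle[OF V(2,1,3)] dist_triangle[OF V] sym by simp_all
  have "even (d x y + d y z + d x z)"
    using even_dist V by auto
  then obtain s where s: "d x y + d y z + d x z = 2 * s"
    by (elim evenE)
  \<comment> \<open>At each of the three vertices, \<open>r\<close> is the Gromov product of the other two.\<close>
  define r where "r a = d x a + d y a + d z a - s" for a
  have r: "r x + s = d x y + d x z" "r y + s = d x y + d y z" "r z + s = d x z + d y z"
    using V tri s sym by (simp_all add: r_def)
  have "r x \<le> d x y"
    using r tri s by linarith
  \<comment> \<open>\<open>p\<close> only selects the colour class in which all three parity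
    conditions hold.\<close>
  then obtain p where p: "p \<in> V" "d x p = r x" "d x y = r x + d p y"
    using geodesic_point[OF V(1,2)] by metis
  have yp: "d y p = r y"
    using p r s dist_sym[OF V(2) p(1)] by linarith
  have "even (d x p + d x z + d z p)"
    using even_dist[OF V(1) p(1)] even_dist[OF V(1,3)] even_dist[OF V(3) p(1)] by auto
  moreover have "d x z = r x + r z"
    using r s by linarith
  ultimately have zp: "even (r z + d z p)"
    using p(2) by presburger
  obtain w where w: "w \<in> V" "\<And>a. a \<in> {x, y, z} \<Longrightarrow> d a w \<le> r a"
  proof (rule balls_intersect[OF p(1), of "{x, y, z}" r])
    show "even (r a + d a p)" if "a \<in> {x, y, z}" for a
      using that p(2) yp zp by auto
    show "d a b \<le> r a + r b" if "a \<in> {x, y, z}" "b \<in> {x, y, z}" for a b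
    proof -
      have "d x y \<le> r x + r y" "d y z \<le> r y + r z" "d x z \<le> r x + r z"
        using r s by linarith+
      then show ?thesis
        using that V sym by auto
    qed
  qed (use V in auto)
  have symw: "d w x = d x w" "d w y = d y w" "d w z = d z w"
    using dist_sym V w(1) by blast+
  have "d x w \<le> r x" "d y w \<le> r y" "d z w \<le> r z"
    using w(2) by auto
  moreover have "d x y \<le> d x w + d y w" "d y z \<le> d y w + d z w" "d x z \<le> d x w + d z w"
    using dist_triangle[OF V(1) w(1) V(2)] dist_triangle[OF V(2) w(1) V(3)]
      dist_triangle[OF V(1) w(1) V(3)] symw by simp_all
  ultimately have "d x w + d y w = d x y" "d y w + d z w = d y z" "d z w + d x w = d x z"
    using r s by linarith+
  then have "w \<in> ginterval G x y \<inter> ginterval G y z \<inter> ginterval G z x"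
    using w(1) symw sym by (simp add: ginterval_iff)
  then show "ginterval G x y \<inter> ginterval G y z \<inter> ginterval G z x \<noteq> {}"
    by blast
qed

text \<open>
  On integers of one parity this function is odd, monotone and 1-Lipschitz. These properties make
  the balls below intersect pairwise.
\<close>

definition shift :: "int \<Rightarrow> int" where
  "shift h = (if h \<ge> 2 then 2 else if h \<le> -2 then -2 else 0)"

lemma shift_uminus: "shift (- h) = - shift h"
  by (simp add: shift_def)

text \<open>Nonpositive lower bounds survive the shift. Parity excludes cases such as
  \<open>h = 1\<close>, \<open>h' = -2\<close>, where the sum would drop from -1 to -2.\<close>

lemma shift_add_ge:
  assumes "even (h + h')" "c \<le> 0" "c \<le> h + h'"
  shows "c \<le> shift h + shift h'"
proof -
  have "h + h' \<noteq> -1" "h + h' \<noteq> -3"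
    using assms(1) by presburger+
  then show ?thesis
    using assms unfolding shift_def by (auto split: if_splits)
qed

text \<open>\<open>w\<close> plays the role of \<open>u\<close> moved two steps towards
  \<open>v\<close>. The triangle inequalities through \<open>u\<close> and through \<open>v\<close>
  are the two bounds that \<open>shift_add_ge\<close> requires.\<close>

lemma shifted_vertex:
  assumes V: "u \<in> V" "v \<in> V" and A: "finite A" "A \<noteq> {}" "A \<subseteq> V"
  obtains w where "w \<in> V"
    "\<And>a. a \<in> A \<Longrightarrow> int (d a w) \<le> int (d a u) + shift (int (d a v) - int (d a u))"
proof -
  define h where "h a = int (d a v) - int (d a u)" for a
  \<comment> \<open>\<open>nat\<close> cuts nothing off: a shift by -2 occurs only if
    \<open>d a u\<close> is at least 2.\<close>
  define r where "r a = nat (int (d a u) + shift (h a))" for a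
  have r: "int (r a) = int (d a u) + shift (h a)" for a
    by (simp add: r_def shift_def h_def)
  have "even (int (r a + d a u))" for a
    by (simp add: r shift_def)
  then have par: "even (r a + d a u)" for a
    by simp
  have "d a b \<le> r a + r b" if ab: "a \<in> A" "b \<in> A" for a b
  proof -
    have abV: "a \<in> V" "b \<in> V"
      using ab A(3) by auto
    have "d a b \<le> d a u + d b u" "d a b \<le> d a v + d b v"
      using dist_triangle[OF abV(1) V(1) abV(2)] dist_triangle[OF abV(1) V(2) abV(2)]
        dist_sym[OF abV(2) V(1)] dist_sym[OF abV(2) V(2)] by simp_all
    moreover have "even (h a + h b)"
      using even_dist[OF abV(1) V(1)] even_dist[OF abV(1) V(2)] even_dist[OF abV(2) V(1)]
        even_dist[OF abV(2) V(2)] by (auto simp: h_def)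
    ultimately have "int (d a b) - int (d a u) - int (d b u) \<le> shift (h a) + shift (h b)"
      by (intro shift_add_ge) (auto simp: h_def)
    then show ?thesis
      using r[of a] r[of b] by linarith
  qed
  then obtain w where w: "w \<in> V" "\<And>a. a \<in> A \<Longrightarrow> d a w \<le> r a"
    using balls_intersect[OF V(1) A] par by metis
  have "int (d a w) \<le> int (d a u) + shift (int (d a v) - int (d a u))" if "a \<in> A" for a
    using w(2)[OF that] r[of a] by (simp add: h_def)
  then show ?thesis
    using that w(1) by blast
qed

text \<open>Move \<open>u\<close> towards \<open>v\<close> and \<open>v\<close> towards
  \<open>u\<close>. As \<open>shift\<close> is odd, the changes cancel in the sum, so both new
  vertices are medians.\<close>

lemma median_between:
  assumes m: "set_mset m \<subseteq> V" and uv: "u \<in> med m" "v \<in> med m" "d u v > 2"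
  obtains w where "w \<in> med m" "d u w < d u v" "d w v < d u v"
proof -
  have V: "u \<in> V" "v \<in> V"
    using uv by (auto simp: med_def)
  \<comment> \<open>Including \<open>u\<close> and \<open>v\<close> bounds the distances from
    \<open>w\<close> to both of them.\<close>
  let ?A = "insert u (insert v (set_mset m))"
  have A: "finite ?A" "?A \<noteq> {}" "?A \<subseteq> V"
    using V m by auto
  obtain w where w: "w \<in> V"
    "\<And>a. a \<in> ?A \<Longrightarrow> int (d a w) \<le> int (d a u) + shift (int (d a v) - int (d a u))"
    using shifted_vertex[OF V A] by metis
  obtain w' where w': "w' \<in> V"
    "\<And>a. a \<in> ?A \<Longrightarrow> int (d a w') \<le> int (d a v) + shift (int (d a u) - int (d a v))"
    using shifted_vertex[OF V(2,1) A] by metis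
  have "d a w + d a w' \<le> d a u + d a v" if "a \<in> ?A" for a
    using w(2)[OF that] w'(2)[OF that] shift_uminus[of "int (d a v) - int (d a u)"] by simp
  then have "d w a + d w' a \<le> d u a + d v a" if "a \<in># m" for a
    using that m V w(1) w'(1) dist_sym[of a w] dist_sym[of a w'] dist_sym[of a u] dist_sym[of a v]
    by (metis insertCI subsetD)
  then have "remote m w + remote m w' \<le> remote m u + remote m v"
    unfolding remote_def sum_mset.distrib[symmetric] by (rule sum_mset_mono)
  then have "w \<in> med m"
    using uv w(1) w'(1) by (fastforce simp: med_def)
  moreover have "d u w < d u v"
    using w(2)[of u] uv(3) V by (simp add: shift_def)
  moreover have "d w v < d u v"
    using w(2)[of v] uv(3) V dist_sym[of v u] dist_sym[of v w] w(1) by (simp add: shift_def)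
  ultimately show ?thesis
    using that by blast
qed

text \<open>Induction on the distance: \<open>median_between\<close> splits any pair of medians more
  than 2 apart into two closer pairs.\<close>

lemma Helly_G2_connected_medians: "G2_connected_medians G"
  unfolding G2_connected_medians_def
proof
  fix \<pi>
  assume "\<pi> \<in> profiles G"
  then have m: "set_mset (mset \<pi>) \<subseteq> V"
    by auto
  let ?H = "with_proj (graph_square G) \<restriction> Med G \<pi>"
  interpret K: pair_wf_digraph "mk_symmetric ?H"
    by unfold_locales (auto simp: parcs_mk_symmetric)
  have "u \<rightarrow>\<^sup>*\<^bsub>mk_symmetric ?H\<^esub> v" if "u \<in> med (mset \<pi>)" "v \<in> med (mset \<pi>)" for u v
    using that
  proof (induction "d u v" arbitrary: u v rule: less_induct)
    case less
    have V: "u \<in> V" "v \<in> V"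
      using less.prems by (auto simp: med_def)
    show ?case
    proof (cases "d u v > 2")
      case True
      then obtain w where "w \<in> med (mset \<pi>)" "d u w < d u v" "d w v < d u v"
        using median_between[OF m less.prems] by metis
      then show ?thesis
        using less K.reachable_trans by blast
    next
      case False
      show ?thesis
      proof (cases "u = v")
        case True
        moreover have "v \<in> pverts (mk_symmetric ?H)"
          using less.prems by (simp add: Med_eq_med)
        ultimately show ?thesis
          using K.reachable_refl by blast
      next
        case neq: False
        have "(u, v) \<in> parcs (mk_symmetric ?H)"
          using False neq V less.prems
          by (auto simp: parcs_mk_symmetric graph_square_def Med_eq_med)
        then show ?thesis
          by (intro K.reachable_adjI) simp
      qed
    qed
  qed
  then show "connected ?H"
    using Med_nonempty[of \<pi>] by (auto simp: connected_def strongly_connected_def Med_eq_med)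
qed

end

theorem theorem20:
  fixes G :: "'a pair_pre_digraph"
  assumes "connected_simple_graph G"
  shows "(modular_graph G \<and> G2_connected_medians G \<longrightarrow> ABC_graph G) \<and>
         (bipartite_Helly_graph G \<longrightarrow> ABC_graph G)"
proof -
  interpret connected_graph G
    by unfold_locales (rule assms)
  have modular: "ABC_graph G" if "modular_graph G" "G2_connected_medians G"
  proof -
    interpret modular_connected_graph G
      by unfold_locales (rule that)
    show ?thesis
      by (rule ABC_graph[OF that(2)])
  qed
  moreover have "ABC_graph G" if Helly: "bipartite_Helly_graph G"
  proof -
    obtain X Y where "bipartition G X Y" "Helly_property (half_balls G X Y)"
      using Helly by (auto simp: bipartite_Helly_graph_def)
    then interpret Helly_graph G X Y
      by unfold_locales
    show ?thesis
      using modular Helly_modular Helly_G2_connected_medians by blast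
  qed
  ultimately show ?thesis by blast
qed

end
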